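(* Let $\mathbf{v}_0$ be a divergence-free vector field on $B_{r_0}$ with $\operatorname{curl}\mathbf{v}_0\in L_1(B_{r_0})$ which satisfies the no-slip condition $\mathbf{v}_0(\mathbf{x})=0$ for $|\mathbf{x}|=r_0$, the infinity condition $\mathbf{v}_0(\mathbf{x})\to\mathbf{v}_\infty$ as $|\mathbf{x}|\to\infty$, and the zero-circularity condition $\lim_{R\to\infty}\oint_{|\mathbf{x}|=R}\mathbf{v}_0\cdot d\mathbf{l}=0$. Let $\mathbf{v}(t,\cdot)$, $t\ge 0$, be a flow of velocity fields with $\mathbf{v}(0,\cdot)=\mathbf{v}_0$ as described in the context, and let $w(t,\cdot)=\operatorname{curl}\mathbf{v}(t,\cdot)$ be the corresponding vorticity flow. Then $\operatorname{curl}\mathbf{v}_0\in M$, and in order that the no-slip condition be conserved by the flow (that is, $\mathbf{v}(t,\mathbf{x})=0$ for $|\mathbf{x}|=r_0$ and all $t>0$) it is necessary that $M$ be invariant under the flow, i.e. that $w(t,\cdot)\in M$ for every $t>0$.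
   Context: Let $r_0>0$ and $B_{r_0}=\{\mathbf{x}\in\mathbb{R}^2: |\mathbf{x}|>r_0\}$ (the exterior of a disc). Points $\mathbf{x}=(x_1,x_2)$ are identified with complex numbers $z=x_1+ix_2=re^{i\varphi}$. For $\mathbf{v}=(v_1,v_2)$, $\operatorname{curl}\mathbf{v}=\partial_{x_1}v_2-\partial_{x_2}v_1$ (a real scalar function). The constant vector $\mathbf{v}_\infty=(v_{\infty,x},v_{\infty,y})\in\mathbb{R}^2$ is given. The Fourier coefficients of its radial component are $$v_{\infty,r,k}=\frac{\delta_{|k|,1}}{2}\,(v_{\infty,x}-ik\,v_{\infty,y}),\qquad k\in\mathbb{Z}.$$ Define the affine subspace $$M=\Big\{w\in L_1(B_{r_0})\ \Big|\ \int_{B_{r_0}}\frac{w(\mathbf{x})}{z^k}\,d\mathbf{x}=4\pi i k\,v_{\infty,r,k},\ k\ge 0,\ k\in\mathbb{Z}\Big\},$$ where $w$ is real-valued. Standing assumptions on the flow: for each $t\ge 0$ the field $\mathbf{v}(t,\cdot)$ is divergence-free on $B_{r_0}$, $\operatorname{curl}\mathbf{v}(t,\cdot)\in L_1(B_{r_0})$, $\mathbf{v}(t,\mathbf{x})\to\mathbf{v}_\infty$ as $|\mathbf{x}|\to\infty$, and $\lim_{R\to\infty}\oint_{|\mathbf{x}|=R}\mathbf{v}(t,\cdot)\cdot d\mathbf{l}=0$. *)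

theory Defs
  imports "HOL-Analysis.Analysis"
begin

definition exterior :: "real \<Rightarrow> (real^2) set" where
  "exterior r0 = {x. norm x > r0}"

definition to_complex :: "real^2 \<Rightarrow> complex" where
  "to_complex x = Complex (x $ 1) (x $ 2)"

definition partial_derivative :: "2 \<Rightarrow> (real^2 \<Rightarrow> real) \<Rightarrow> real^2 \<Rightarrow> real" where
  "partial_derivative j f x = deriv (\<lambda>s. f (x + s *\<^sub>R axis j 1)) 0"

definition divergence :: "(real^2 \<Rightarrow> real^2) \<Rightarrow> real^2 \<Rightarrow> real" where
  "divergence v x = partial_derivative 1 (\<lambda>y. v y $ 1) x + partial_derivative 2 (\<lambda>y. v y $ 2) x"

definition curl :: "(real^2 \<Rightarrow> real^2) \<Rightarrow> real^2 \<Rightarrow> real" where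
  "curl v x = partial_derivative 1 (\<lambda>y. v y $ 2) x - partial_derivative 2 (\<lambda>y. v y $ 1) x"

text \<open>Vector fields are understood classically: continuously differentiable in the open exterior
  domain and continuous up to its boundary circle, so that boundary values are attained.
  Values at points with norm less than \<open>r0\<close> are irrelevant.\<close>

definition vector_field :: "real \<Rightarrow> (real^2 \<Rightarrow> real^2) \<Rightarrow> bool" where
  "vector_field r0 v \<longleftrightarrow>
     continuous_on {x. norm x \<ge> r0} v \<and>
     (\<forall>x\<in>exterior r0. v differentiable (at x)) \<and>
     (\<forall>i j. continuous_on (exterior r0) (partial_derivative j (\<lambda>y. v y $ i)))"

definition divergence_free :: "real \<Rightarrow> (real^2 \<Rightarrow> real^2) \<Rightarrow> bool" where
  "divergence_free r0 v \<longleftrightarrow> (\<forall>x\<in>exterior r0. divergence v x = 0)"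

definition L1 :: "(real^2) set \<Rightarrow> (real^2 \<Rightarrow> real) set" where
  "L1 S = {w. set_integrable lebesgue S w}"

definition no_slip :: "real \<Rightarrow> (real^2 \<Rightarrow> real^2) \<Rightarrow> bool" where
  "no_slip r0 v \<longleftrightarrow> (\<forall>x. norm x = r0 \<longrightarrow> v x = 0)"

definition line_integral :: "(real \<Rightarrow> real^2) \<Rightarrow> (real^2 \<Rightarrow> real^2) \<Rightarrow> real" where
  "line_integral \<gamma> v =
     integral {0..1} (\<lambda>s. v (\<gamma> s) \<bullet> vector_derivative \<gamma> (at s within {0..1}))"

definition circle :: "real \<Rightarrow> real \<Rightarrow> real^2" where
  "circle R s = vector [R * cos (2 * pi * s), R * sin (2 * pi * s)]"

definition zero_circularity :: "(real^2 \<Rightarrow> real^2) \<Rightarrow> bool" where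
  "zero_circularity v \<longleftrightarrow> ((\<lambda>R. line_integral (circle R) v) \<longlongrightarrow> 0) at_top"

definition radial_coeff :: "real^2 \<Rightarrow> int \<Rightarrow> complex" where
  "radial_coeff vinf k =
     (if \<bar>k\<bar> = 1 then 1 else 0) / 2 *
       (complex_of_real (vinf $ 1) - \<i> * of_int k * complex_of_real (vinf $ 2))"

definition moment_space :: "real \<Rightarrow> real^2 \<Rightarrow> (real^2 \<Rightarrow> real) set" where
  "moment_space r0 vinf =
     {w \<in> L1 (exterior r0). \<forall>k::int. k \<ge> 0 \<longrightarrow>
        (LINT x : exterior r0 | lebesgue. complex_of_real (w x) / to_complex x powi k)
          = 4 * complex_of_real pi * \<i> * of_int k * radial_coeff vinf k}"

end

theory Submission
  imports Defs
begin

text \<open>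
  Identify the plane with \<open>\<complex>\<close> and encode a velocity field \<open>v\<close> by the complex function
  \<open>f = v\<^sub>1 - \<i> v\<^sub>2\<close>. Then \<open>(\<partial>\<^sub>1 + \<i> \<partial>\<^sub>2) f = div v - \<i> curl v\<close>, so for a
  divergence-free field \<open>curl v = \<i> (\<partial>\<^sub>1 + \<i> \<partial>\<^sub>2) f\<close>. Away from the origin \<open>z\<^sup>-\<^sup>n\<close> is
  holomorphic, hence annihilated by \<open>\<partial>\<^sub>1 + \<i> \<partial>\<^sub>2\<close>, and therefore also
  \<open>curl v z\<^sup>-\<^sup>n = \<i> (\<partial>\<^sub>1 + \<i> \<partial>\<^sub>2) (f z\<^sup>-\<^sup>n)\<close>. Green's theorem on the annulus
  \<open>a \<le> |z| \<le> b\<close> (lemma \<open>green_annulus\<close>) turns the moment of the vorticity over the annulus into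
  the difference of the contour integrals of \<open>f z\<^sup>-\<^sup>n dz\<close> over the two circles
  (lemma \<open>moment_annulus\<close>).

  As \<open>a\<close> tends to \<open>r0\<close>, the inner contour integral vanishes because of the no-slip condition. As
  \<open>b\<close> tends to infinity, the moments converge because the vorticity is integrable and \<open>z\<^sup>-\<^sup>n\<close> is
  bounded on the exterior domain. The outer contour integral tends to \<open>2 \<pi> \<i>\<close> times the limit of
  \<open>z f z\<^sup>-\<^sup>n\<close> at infinity: this is \<open>vinf $ 1 - \<i> vinf $ 2\<close> for \<open>n = 1\<close>
  and \<open>0\<close> for \<open>n \<ge> 2\<close>. For \<open>n = 0\<close> the limit of \<open>z f\<close> need not exist; there the real part of the
  contour integral is the circulation, which tends to \<open>0\<close> by zero circularity, and the moment
  itself is real. So every single no-slip field has its vorticity in the moment space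
  (lemma \<open>no_slip_imp_curl_in_moment_space\<close>), and both claims apply this to a velocity field at a
  fixed time.
\<close>

section \<open>Circles and complex coordinates\<close>

lemma to_complex_circle: "to_complex (circle r s) = of_real r * cis (2 * pi * s)"
  by (simp add: to_complex_def circle_def complex_eq_iff)

lemma norm_to_complex: "norm (to_complex x) = norm x"
  by (simp add: to_complex_def norm_vec_def L2_set_def sum_2 cmod_def)

lemma norm_circle: "r \<ge> 0 \<Longrightarrow> norm (circle r s) = r"
  by (simp flip: norm_to_complex add: to_complex_circle norm_mult)

lemma to_complex_eq: "to_complex x = of_real (x $ 1) + \<i> * of_real (x $ 2)"
  by (simp add: to_complex_def complex_eq_iff)

lemma bounded_linear_to_complex: "bounded_linear to_complex"
  unfolding to_complex_eq[abs_def]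
  by (intro bounded_linear_intros bounded_linear_compose [OF bounded_linear_of_real] bounded_linear_vec_nth)

lemma to_complex_eq_0_iff [simp]: "to_complex x = 0 \<longleftrightarrow> x = 0"
  by (subst norm_eq_zero [symmetric]) (simp add: norm_to_complex)

lemma to_complex_inverse: "to_complex (vector [Re z, Im z]) = z"
  by (simp add: to_complex_def)

text \<open>Only the two scalar coefficients depend on \<open>r\<close> and \<open>s\<close>, so continuity and derivatives can be
  computed coefficientwise.\<close>

lemma circle_altdef:
  "circle r s = (r * cos (2 * pi * s)) *\<^sub>R axis 1 1 + (r * sin (2 * pi * s)) *\<^sub>R axis 2 1"
  by (simp add: circle_def vec_eq_iff forall_2 axis_def)

lemma vec2_eq: "x = (x $ 1) *\<^sub>R axis 1 1 + (x $ 2) *\<^sub>R axis 2 1" for x :: "real^2"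
  by (simp add: vec_eq_iff forall_2 axis_def)

lemma continuous_on_circle [continuous_intros]:
  fixes f g :: "'a::t2_space \<Rightarrow> real"
  assumes "continuous_on S f" "continuous_on S g"
  shows "continuous_on S (\<lambda>x. circle (f x) (g x))"
  unfolding circle_altdef
  by (intro continuous_intros assms continuous_on_cos continuous_on_sin)

lemma continuous_on_to_complex [continuous_intros]:
  "continuous_on S f \<Longrightarrow> continuous_on S (\<lambda>x. to_complex (f x))"
  by (rule bounded_linear.continuous_on [OF bounded_linear_to_complex])

section \<open>Integration in polar coordinates\<close>

lemma ex_2: "(\<exists>i::2. P i) \<longleftrightarrow> P 1 \<or> P 2"
  using forall_2 [of "\<lambda>i. \<not> P i"] by blast

text \<open>Variables are changed on \<open>real^2\<close>, iterated integrals come from \<open>real \<times> real\<close>. The coordinate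
  map between the two types sends boxes to boxes of the same content, so it preserves integrals.\<close>

lemma has_integral_cart_2:
  fixes f :: "real^2 \<Rightarrow> 'a::banach"
  assumes "continuous_on (cbox (vector [a, c]) (vector [b, d])) f"
  shows "(f has_integral integral {a..b} (\<lambda>x. integral {c..d} (\<lambda>y. f (vector [x, y]))))
           (cbox (vector [a, c]) (vector [b, d]))"
proof -
  let ?h = "\<lambda>q::real\<times>real. vector [fst q, snd q] :: real^2"
  let ?g = "\<lambda>p::real^2. (p $ 1, p $ 2)"
  have h_eq: "?h q = fst q *\<^sub>R axis 1 1 + snd q *\<^sub>R axis 2 1" for q
    by (simp add: vec_eq_iff forall_2 axis_def)
  have img_h: "?h ` cbox u w = cbox (?h u) (?h w)" for u w
  proof -
    have "x \<in> ?h ` cbox u w" if "x \<in> cbox (?h u) (?h w)" for x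
      using that
      by (intro image_eqI [where x = "?g x"])
         (cases u; cases w; auto simp: mem_box_cart forall_2 vec_eq_iff cbox_Pair_eq)+
    then show ?thesis
      by (cases u; cases w) (auto simp: mem_box_cart forall_2 cbox_Pair_eq)
  qed
  have img_g: "?g ` cbox u w = cbox (?g u) (?g w)" for u w
  proof -
    have "q \<in> ?g ` cbox u w" if "q \<in> cbox (?g u) (?g w)" for q
      using that
      by (intro image_eqI [where x = "?h q"])
         (auto simp: mem_box_cart forall_2 cbox_Pair_eq)
    then show ?thesis
      by (auto simp: mem_box_cart forall_2 cbox_Pair_eq)
  qed
  have cont: "continuous_on (cbox (a, c) (b, d)) (\<lambda>q. f (?h q))"
  proof (rule continuous_on_compose2 [OF assms])
    show "continuous_on (cbox (a, c) (b, d)) ?h"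
      unfolding h_eq by (intro continuous_intros)
    show "?h ` cbox (a, c) (b, d) \<subseteq> cbox (vector [a, c]) (vector [b, d])"
      unfolding img_h by simp
  qed
  have "((\<lambda>p. f (?h (?g p))) has_integral (1/1) *\<^sub>R integral (cbox (a, c) (b, d)) (\<lambda>q. f (?h q)))
          (?h ` cbox (a, c) (b, d))"
  proof (rule has_integral_twiddle)
    show "\<exists>w z. ?g ` cbox u v = cbox w z" for u v
      using img_g by blast
    show "\<exists>w z. ?h ` cbox u v = cbox w z" for u v
      using img_h by blast
    show "Sigma_Algebra.measure lborel (?g ` cbox u v) = 1 * Sigma_Algebra.measure lborel (cbox u v)" for u v
      unfolding img_g content_Pair content_cbox_if_cart
      by (simp add: UNIV_2 interval_eq_empty_cart ex_2)
    show "((\<lambda>q. f (?h q)) has_integral integral (cbox (a, c) (b, d)) (\<lambda>q. f (?h q))) (cbox (a, c) (b, d))"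
      using cont by (intro integrable_integral integrable_continuous)
  qed (auto simp: vec_eq_iff forall_2 intro!: continuous_intros)
  moreover have "f (?h (?g p)) = f p" for p
    by (rule arg_cong [where f = f]) (simp add: vec_eq_iff forall_2)
  ultimately have "(f has_integral integral (cbox (a, c) (b, d)) (\<lambda>q. f (?h q))) (cbox (vector [a, c]) (vector [b, d]))"
    by (simp add: img_h)
  also have "integral (cbox (a, c) (b, d)) (\<lambda>q. f (?h q))
      = integral (cbox a b) (\<lambda>x. integral (cbox c d) (\<lambda>y. f (?h (x, y))))"
    by (rule integral_prod_continuous [OF cont])
  finally show ?thesis
    by simp
qed

lemma has_derivative_circle:
  "((\<lambda>p::real^2. circle (p $ 1) (p $ 2)) has_derivative
     (\<lambda>h. vector [h $ 1 * cos (2 * pi * p $ 2) - h $ 2 * (2 * pi * p $ 1 * sin (2 * pi * p $ 2)),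
                  h $ 1 * sin (2 * pi * p $ 2) + h $ 2 * (2 * pi * p $ 1 * cos (2 * pi * p $ 2))]))
   (at p within S)"
proof -
  have nth: "((\<lambda>p::real^2. p $ i) has_derivative (\<lambda>h. h $ i)) (at p within S)" for i
    by (rule bounded_linear.has_derivative [OF bounded_linear_vec_nth has_derivative_ident])
  have angle: "((\<lambda>p::real^2. 2 * pi * p $ 2) has_derivative (\<lambda>h. 2 * pi * h $ 2)) (at p within S)"
    by (rule has_derivative_mult_right [OF nth])
  show ?thesis
    unfolding circle_altdef
    by (rule has_derivative_eq_rhs,
        rule has_derivative_add [OF
          has_derivative_scaleR_left [OF has_derivative_mult [OF nth has_derivative_cos [OF angle]]]
          has_derivative_scaleR_left [OF has_derivative_mult [OF nth has_derivative_sin [OF angle]]]])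
       (simp add: fun_eq_iff vec_eq_iff forall_2 axis_def)
qed

text \<open>In the application \<open>c\<close> is \<open>2 * pi * r\<close> and \<open>t\<close> the angle \<open>2 * pi * s\<close>, which gives the Jacobian
  \<open>2 * pi * r\<close> of polar coordinates whose angular variable \<open>s\<close> runs through the unit interval.\<close>

lemma det_circle_jacobian:
  "det (matrix (\<lambda>h::real^2. vector [h $ 1 * cos t - h $ 2 * (c * sin t), h $ 1 * sin t + h $ 2 * (c * cos t)])) = c"
proof -
  have "det (matrix (\<lambda>h::real^2. vector [h $ 1 * cos t - h $ 2 * (c * sin t), h $ 1 * sin t + h $ 2 * (c * cos t)]))
     = c * ((cos t)\<^sup>2 + (sin t)\<^sup>2)"
    unfolding distrib_left by (simp add: det_2 matrix_def axis_def power2_eq_square algebra_simps)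
  then show ?thesis by simp
qed

text \<open>The rectangle is half-open in the angular direction, so that polar coordinates map it
  bijectively onto the full closed annulus and no slit has to be removed from the annulus.\<close>

lemma inj_on_circle:
  assumes "a > 0"
  shows "inj_on (\<lambda>p::real^2. circle (p $ 1) (p $ 2)) {p. a \<le> p $ 1 \<and> p $ 1 \<le> b \<and> 0 \<le> p $ 2 \<and> p $ 2 < 1}"
proof (rule inj_onI, clarify)
  fix p q :: "real^2"
  assume *: "a \<le> p $ 1" "a \<le> q $ 1" "0 \<le> p $ 2" "p $ 2 < 1" "0 \<le> q $ 2" "q $ 2 < 1"
    and eq: "circle (p $ 1) (p $ 2) = circle (q $ 1) (q $ 2)"
  from eq have r: "p $ 1 = q $ 1"
    by (metis norm_circle * assms less_imp_le order_trans)
  with eq * assms have "sin (2 * pi * p $ 2) = sin (2 * pi * q $ 2) \<and> cos (2 * pi * p $ 2) = cos (2 * pi * q $ 2)"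
    by (simp add: circle_def vec_eq_iff forall_2)
  then obtain n :: int where "2 * pi * p $ 2 = 2 * pi * q $ 2 + 2 * pi * n"
    using sin_cos_eq_iff by blast
  then have "2 * pi * p $ 2 = 2 * pi * (q $ 2 + n)"
    by (simp add: algebra_simps)
  then have n: "p $ 2 = q $ 2 + n"
    by simp
  with * have "\<bar>real_of_int n\<bar> < 1" by linarith
  then have "n = 0" by linarith
  with n r show "p = q" by (simp add: vec_eq_iff forall_2)
qed

lemma circle_surj:
  assumes "x \<noteq> 0"
  obtains s where "0 \<le> s" "s < 1" "x = circle (norm x) s"
proof -
  have "(x $ 1 / norm x)\<^sup>2 + (x $ 2 / norm x)\<^sup>2 = ((x $ 1)\<^sup>2 + (x $ 2)\<^sup>2) / (norm x)\<^sup>2"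
    by (simp add: power_divide add_divide_distrib)
  also have "(x $ 1)\<^sup>2 + (x $ 2)\<^sup>2 = (norm x)\<^sup>2"
    by (simp add: norm_vec_def L2_set_def sum_2)
  finally have "(x $ 1 / norm x)\<^sup>2 + (x $ 2 / norm x)\<^sup>2 = 1"
    using assms by simp
  from sincos_total_2pi [OF this] obtain t
    where t: "0 \<le> t" "t < 2 * pi" "x $ 1 / norm x = cos t" "x $ 2 / norm x = sin t" .
  from assms have "x $ 1 = norm x * (x $ 1 / norm x)" "x $ 2 = norm x * (x $ 2 / norm x)"
    by simp_all
  with t(3,4) have "x $ 1 = norm x * cos t" "x $ 2 = norm x * sin t"
    by simp_all
  then have "x = circle (norm x) (t / (2 * pi))"
    by (simp add: circle_def vec_eq_iff forall_2)
  with t(1,2) show thesis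
    by (intro that [of "t / (2 * pi)"]) auto
qed

lemma image_circle:
  assumes "a > 0"
  shows "(\<lambda>p::real^2. circle (p $ 1) (p $ 2)) ` {p. a \<le> p $ 1 \<and> p $ 1 \<le> b \<and> 0 \<le> p $ 2 \<and> p $ 2 < 1}
    = {x. a \<le> norm x \<and> norm x \<le> b}"
proof (intro equalityI subsetI)
  fix x :: "real^2"
  assume x: "x \<in> {x. a \<le> norm x \<and> norm x \<le> b}"
  with assms have "x \<noteq> 0" by auto
  then obtain s where s: "0 \<le> s" "s < 1" "x = circle (norm x) s"
    by (rule circle_surj)
  show "x \<in> (\<lambda>p::real^2. circle (p $ 1) (p $ 2)) ` {p. a \<le> p $ 1 \<and> p $ 1 \<le> b \<and> 0 \<le> p $ 2 \<and> p $ 2 < 1}"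
  proof (rule image_eqI)
    show "x = circle (vector [norm x, s] $ 1) ((vector [norm x, s] :: real^2) $ 2)"
      unfolding vector_2 by (rule s(3))
  qed (use s(1,2) x in auto)
qed (use assms in \<open>auto simp: norm_circle\<close>)

text \<open>The change of variables theorem for \<open>real^'n\<close>-valued functions applies to \<open>J \<circ> f\<close>, where \<open>J\<close>
  is the linear isomorphism from \<open>complex\<close> to \<open>real^2\<close> with inverse \<open>to_complex\<close>.\<close>

lemma polar_integral_annulus:
  fixes f :: "real^2 \<Rightarrow> complex"
  assumes "a > 0" and cont: "continuous_on {x. a \<le> norm x \<and> norm x \<le> b} f"
  shows "integral {x. a \<le> norm x \<and> norm x \<le> b} f
           = integral {a..b} (\<lambda>r. integral {0..1} (\<lambda>s. (2 * pi * r) *\<^sub>R f (circle r s)))"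
proof -
  let ?A = "{x::real^2. a \<le> norm x \<and> norm x \<le> b}"
  let ?P = "\<lambda>p::real^2. circle (p $ 1) (p $ 2)"
  let ?C = "cbox (vector [a, 0]) (vector [b, 1]) :: (real^2) set"
  let ?S = "{p::real^2. a \<le> p $ 1 \<and> p $ 1 \<le> b \<and> 0 \<le> p $ 2 \<and> p $ 2 < 1}"
  let ?u = "\<lambda>p::real^2. (2 * pi * p $ 1) *\<^sub>R f (?P p)"
  let ?I = "integral {a..b} (\<lambda>r. integral {0..1} (\<lambda>s. (2 * pi * r) *\<^sub>R f (circle r s)))"
  define J :: "complex \<Rightarrow> real^2" where "J z = vector [Re z, Im z]" for z
  have J_eq: "J z = Re z *\<^sub>R axis 1 1 + Im z *\<^sub>R axis 2 1" for z
    by (simp add: J_def vec_eq_iff forall_2 axis_def)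
  have J: "bounded_linear J"
    unfolding J_eq[abs_def]
    by (intro bounded_linear_add bounded_linear_compose [OF bounded_linear_scaleR_left]
              bounded_linear_Re bounded_linear_Im)
  have to_complex_J: "to_complex (J z) = z" for z
    by (simp add: J_def to_complex_inverse)
  have cont_u: "continuous_on ?C ?u"
  proof (intro continuous_intros continuous_on_compose2 [OF cont])
    show "?P ` ?C \<subseteq> ?A"
      using \<open>a > 0\<close> by (auto simp: mem_box_cart forall_2 norm_circle)
  qed
  have int_u: "(?u has_integral ?I) ?C"
    using has_integral_cart_2 [OF cont_u] by simp
  have "?S \<subseteq> ?C"
    by (auto simp: mem_box_cart forall_2)
  have S_eq: "?S = ?C \<inter> {p. p $ 2 < 1}"
    by (auto simp: mem_box_cart forall_2)
  have S_borel: "?S \<in> sets borel"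
    unfolding S_eq by (intro sets.Int borel_closed borel_open closed_cbox open_halfspace_component_lt_cart)
  then have S: "?S \<in> sets lebesgue"
    by auto
  have abs_u: "?u absolutely_integrable_on ?S"
    using absolutely_integrable_continuous [OF cont_u] S \<open>?S \<subseteq> ?C\<close>
    by (rule set_integrable_subset)
  \<comment> \<open>The half-open rectangle and the closed one differ by an edge.\<close>
  have neg: "negligible {p::real^2. p $ 2 = 1}"
    using negligible_standard_hyperplane [of "axis 2 (1::real) :: real^2" 1]
    by (simp add: inner_axis axis_in_Basis_iff)
  have "integral ?S ?u = integral ?C ?u"
    by (intro integral_spike_set negligible_subset [OF neg]) (auto simp: mem_box_cart forall_2)
  with int_u have u_S: "integral ?S ?u = ?I"
    by (simp add: integral_unique)
  let ?G = "\<lambda>p. \<bar>det (matrix (\<lambda>h::real^2. vector [h $ 1 * cos (2 * pi * p $ 2) - h $ 2 * (2 * pi * p $ 1 * sin (2 * pi * p $ 2)),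
                  h $ 1 * sin (2 * pi * p $ 2) + h $ 2 * (2 * pi * p $ 1 * cos (2 * pi * p $ 2))] :: real^2))\<bar> *\<^sub>R J (f (?P p))"
  have jac: "?G p = J (?u p)" if "p \<in> ?S" for p
    using that \<open>a > 0\<close> by (simp add: det_circle_jacobian linear_scale [OF bounded_linear.linear [OF J]])
  have "(\<lambda>p. J (?u p)) absolutely_integrable_on ?S \<and> integral ?S (\<lambda>p. J (?u p)) = J ?I"
    using absolutely_integrable_linear [OF abs_u J]
      integral_linear [OF set_lebesgue_integral_eq_integral(1) [OF abs_u] J] u_S
    by (simp only: o_def)
  moreover have "?G absolutely_integrable_on ?S \<longleftrightarrow> (\<lambda>p. J (?u p)) absolutely_integrable_on ?S"
    by (intro set_integrable_cong refl jac)
  moreover have "integral ?S ?G = integral ?S (\<lambda>p. J (?u p))"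
    by (intro integral_cong jac)
  ultimately have "(\<lambda>x. J (f x)) absolutely_integrable_on (?P ` ?S) \<and> integral (?P ` ?S) (\<lambda>x. J (f x)) = J ?I"
    using has_absolute_integral_change_of_variables
        [OF S has_derivative_circle inj_on_circle [OF \<open>a > 0\<close>], where f = "\<lambda>x. J (f x)" and b = "J ?I"]
    by (simp only: simp_thms)
  then have JA: "(\<lambda>x. J (f x)) absolutely_integrable_on ?A" "integral ?A (\<lambda>x. J (f x)) = J ?I"
    unfolding image_circle [OF \<open>a > 0\<close>] by auto
  from integral_linear [OF set_lebesgue_integral_eq_integral(1) [OF JA(1)] bounded_linear_to_complex]
  show "integral ?A f = ?I"
    by (simp add: o_def to_complex_J JA(2))
qed

section \<open>Green's theorem on an annulus\<close>

text \<open>The contour integral of \<open>F(z) dz\<close> over the circle of radius \<open>r\<close>, with \<open>z\<close> parametrized by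
  \<open>circle r\<close>, so that \<open>dz = 2 \<pi> \<i> z ds\<close>.\<close>

definition circle_integral :: "real \<Rightarrow> (real^2 \<Rightarrow> complex) \<Rightarrow> complex" where
  "circle_integral r F = integral {0..1} (\<lambda>s. 2 * pi * \<i> * to_complex (circle r s) * F (circle r s))"

lemma has_vector_derivative_along:
  assumes F: "(F has_derivative (\<lambda>h. h $ 1 *\<^sub>R P + h $ 2 *\<^sub>R Q)) (at (g t))"
    and g: "(g has_vector_derivative g') (at t within S)"
  shows "((\<lambda>t. F (g t)) has_vector_derivative (g' $ 1 *\<^sub>R P + g' $ 2 *\<^sub>R Q)) (at t within S)"
  using has_derivative_compose [OF g [unfolded has_vector_derivative_def] F]
  by (simp add: has_vector_derivative_def scaleR_add_right)

lemma has_vector_derivative_circle_radius: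
  "((\<lambda>r. circle r s) has_vector_derivative circle 1 s) (at r within S)"
  unfolding circle_altdef by (auto intro!: derivative_eq_intros)

lemma has_vector_derivative_cis:
  "((\<lambda>s. cis (2 * pi * s)) has_vector_derivative 2 * pi * \<i> * cis (2 * pi * s)) (at s within S)"
  unfolding has_vector_derivative_def
  by (rule has_derivative_eq_rhs [OF has_derivative_cis [OF has_derivative_mult_right [OF has_derivative_ident]]])
     (simp add: fun_eq_iff scaleR_conv_of_real)

lemma has_vector_derivative_circle_angle:
  "((\<lambda>s. circle r s) has_vector_derivative
     vector [- (2 * pi * r * sin (2 * pi * s)), 2 * pi * r * cos (2 * pi * s)]) (at s within S)"
proof -
  have angle: "((\<lambda>s. 2 * pi * s) has_real_derivative 2 * pi) (at s within S)"
    by (auto intro!: derivative_eq_intros)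
  show ?thesis
    unfolding circle_altdef
    by (rule has_vector_derivative_eq_rhs,
        rule has_vector_derivative_add [OF
          has_vector_derivative_scaleR [OF DERIV_cmult [OF DERIV_chain2 [OF DERIV_cos angle]] has_vector_derivative_const]
          has_vector_derivative_scaleR [OF DERIV_cmult [OF DERIV_chain2 [OF DERIV_sin angle]] has_vector_derivative_const]])
       (simp add: vec_eq_iff forall_2 axis_def)
qed

text \<open>With \<open>\<zeta> = cis (2 * pi * s)\<close> and \<open>z = r \<zeta>\<close>, the polar integrand
  \<open>\<i> * 2 \<pi> r (\<partial>\<^sub>1 + \<i> \<partial>\<^sub>2) F(z)\<close> equals \<open>\<partial>(2 \<pi> \<i> r \<zeta> F(z))/\<partial>r - \<partial>(\<zeta> F(z))/\<partial>s\<close>; in the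
  proof these two derivatives are \<open>U\<close> and \<open>V\<close>. The angular derivative integrates to \<open>0\<close> by
  periodicity. The radial derivative, integrated over \<open>r\<close> first, leaves the two boundary circles.\<close>

lemma green_annulus:
  fixes F P Q :: "real^2 \<Rightarrow> complex"
  assumes "a > 0" "a \<le> b"
    and F: "\<And>x. a \<le> norm x \<Longrightarrow> norm x \<le> b \<Longrightarrow>
              (F has_derivative (\<lambda>h. h $ 1 *\<^sub>R P x + h $ 2 *\<^sub>R Q x)) (at x)"
    and P: "continuous_on {x. a \<le> norm x \<and> norm x \<le> b} P"
    and Q: "continuous_on {x. a \<le> norm x \<and> norm x \<le> b} Q"
  shows "\<i> * integral {x. a \<le> norm x \<and> norm x \<le> b} (\<lambda>x. P x + \<i> * Q x)
           = circle_integral b F - circle_integral a F"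
proof -
  let ?A = "{x::real^2. a \<le> norm x \<and> norm x \<le> b}"
  define \<zeta> where "\<zeta> s = cis (2 * pi * s)" for s
  define U where "U r s = 2 * pi * \<i> * \<zeta> s * (F (circle r s) + r *\<^sub>R (cos (2 * pi * s) *\<^sub>R P (circle r s) + sin (2 * pi * s) *\<^sub>R Q (circle r s)))" for r s
  define V where "V r s = 2 * pi * \<i> * \<zeta> s * F (circle r s) + \<zeta> s *
     (2 * pi * r) *\<^sub>R (- sin (2 * pi * s) *\<^sub>R P (circle r s) + cos (2 * pi * s) *\<^sub>R Q (circle r s))" for r s
  have in_A: "circle r s \<in> ?A" if "r \<in> {a..b}" for r s
    using that \<open>a > 0\<close> by (simp add: norm_circle)
  have contF: "continuous_on ?A F"
    by (rule has_derivative_continuous_on [OF has_derivative_at_withinI [OF F]]) auto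
  have cont_comp: "continuous_on (cbox (a, 0) (b, 1)) (\<lambda>q. H (circle (fst q) (snd q)))" if "continuous_on ?A H" for H :: "real^2 \<Rightarrow> complex"
    by (intro continuous_intros continuous_on_compose2 [OF that])
      (use in_A in \<open>auto simp: cbox_Pair_eq\<close>)
  have cont_zeta: "continuous_on S (\<lambda>x. \<zeta> (f x))" if "continuous_on S f" for f :: "'z::t2_space \<Rightarrow> real" and S
    unfolding \<zeta>_def by (intro continuous_intros that)
  have contU: "continuous_on (cbox (a, 0) (b, 1)) (\<lambda>(r, s). U r s)"
    unfolding U_def case_prod_beta
    by (intro continuous_intros cont_zeta cont_comp contF P Q)
  have contV: "continuous_on (cbox (a, 0) (b, 1)) (\<lambda>(r, s). V r s)"
    unfolding V_def case_prod_beta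
    by (intro continuous_intros cont_zeta cont_comp contF P Q)
  have U: "((\<lambda>r. 2 * pi * \<i> * \<zeta> s * (r *\<^sub>R F (circle r s))) has_vector_derivative U r s) (at r within {a..b})"
    if "r \<in> {a..b}" for r s
  proof -
    have "((\<lambda>r. F (circle r s)) has_vector_derivative
        (cos (2 * pi * s) *\<^sub>R P (circle r s) + sin (2 * pi * s) *\<^sub>R Q (circle r s))) (at r within {a..b})"
      using has_vector_derivative_along [OF F has_vector_derivative_circle_radius, of r s] in_A [OF that]
      by (simp add: circle_def)
    from has_vector_derivative_mult_right [OF has_vector_derivative_scaleR [OF DERIV_ident this]] show ?thesis
      unfolding U_def by (rule has_vector_derivative_eq_rhs) (simp add: add.commute)
  qed
  have V: "((\<lambda>s. \<zeta> s * F (circle r s)) has_vector_derivative V r s) (at s within {0..1})"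
    if "r \<in> {a..b}" for r s
  proof -
    have "((\<lambda>s. F (circle r s)) has_vector_derivative
        (- (2 * pi * r * sin (2 * pi * s)) *\<^sub>R P (circle r s) + (2 * pi * r * cos (2 * pi * s)) *\<^sub>R Q (circle r s)))
        (at s within {0..1})"
      using has_vector_derivative_along [OF F has_vector_derivative_circle_angle, of r s] in_A [OF that] by simp
    from has_vector_derivative_mult [OF has_vector_derivative_cis this] show ?thesis
      unfolding V_def \<zeta>_def by (rule has_vector_derivative_eq_rhs) (simp add: algebra_simps)
  qed
  have intU: "integral {a..b} (\<lambda>r. U r s) = 2 * pi * \<i> * to_complex (circle b s) * F (circle b s)
                - 2 * pi * \<i> * to_complex (circle a s) * F (circle a s)" for s
    using fundamental_theorem_of_calculus [OF \<open>a \<le> b\<close> U, of s]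
    by (simp add: integral_unique to_complex_circle \<zeta>_def scaleR_conv_of_real mult_ac)
  have intV: "integral {0..1} (\<lambda>s. V r s) = 0" if "r \<in> {a..b}" for r
    using fundamental_theorem_of_calculus [OF zero_le_one V [OF that]]
    by (simp add: integral_unique \<zeta>_def circle_altdef)
  have UV: "\<i> * ((2 * pi * r) *\<^sub>R (P (circle r s) + \<i> * Q (circle r s))) = U r s - V r s" for r s
  proof -
    define c d where "c = complex_of_real (cos (2 * pi * s))" and "d = complex_of_real (sin (2 * pi * s))"
    have zeta: "\<zeta> s = c + \<i> * d"
      by (simp add: \<zeta>_def c_def d_def complex_eq_iff)
    have one: "(c + \<i> * d) * (c - \<i> * d) = 1"
    proof -
      have "(c + \<i> * d) * (c - \<i> * d) = of_real ((cos (2 * pi * s))\<^sup>2 + (sin (2 * pi * s))\<^sup>2)"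
        unfolding c_def d_def of_real_add of_real_power by (simp add: algebra_simps power2_eq_square)
      then show ?thesis by simp
    qed
    have U_eq: "U r s = 2 * pi * \<i> * \<zeta> s * (F (circle r s) + of_real r * (c * P (circle r s) + d * Q (circle r s)))"
      by (simp add: U_def c_def d_def scaleR_conv_of_real)
    have V_eq: "V r s = 2 * pi * \<i> * \<zeta> s * F (circle r s) + \<zeta> s * (2 * pi * r * (- d * P (circle r s) + c * Q (circle r s)))"
      by (simp add: V_def c_def d_def scaleR_conv_of_real)
    have "U r s - V r s = 2 * pi * r * \<i> * ((c + \<i> * d) * (c - \<i> * d)) * (P (circle r s) + \<i> * Q (circle r s))"
      unfolding U_eq V_eq zeta by (simp add: algebra_simps)
    then show ?thesis
      unfolding one by (simp add: scaleR_conv_of_real mult_ac)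
  qed
  have contP_iQ: "continuous_on ?A (\<lambda>x. P x + \<i> * Q x)"
    by (intro continuous_intros P Q)
  have slice: "U r integrable_on {0..1}" "V r integrable_on {0..1}" if "r \<in> {a..b}" for r
  proof -
    have pair: "continuous_on {0..1} (\<lambda>s::real. (r, s))"
      by (intro continuous_intros)
    have "(\<lambda>s::real. (r, s)) ` {0..1} \<subseteq> cbox (a, 0) (b, 1)"
      using that by (auto simp: cbox_Pair_eq)
    from continuous_on_compose2 [OF contU pair this] continuous_on_compose2 [OF contV pair this]
    have "continuous_on {0..1} (U r)" "continuous_on {0..1} (V r)"
      by simp_all
    then show "U r integrable_on {0..1}" "V r integrable_on {0..1}"
      by (auto intro: integrable_continuous_interval)
  qed
  have "\<i> * integral ?A (\<lambda>x. P x + \<i> * Q x)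
      = integral {a..b} (\<lambda>r. integral {0..1} (\<lambda>s. \<i> * ((2 * pi * r) *\<^sub>R (P (circle r s) + \<i> * Q (circle r s)))))"
    unfolding polar_integral_annulus [OF \<open>a > 0\<close> contP_iQ] by (simp only: integral_mult_right)
  also have "\<dots> = integral {a..b} (\<lambda>r. integral {0..1} (U r))"
  proof (rule integral_cong)
    fix r assume r: "r \<in> {a..b}"
    show "integral {0..1} (\<lambda>s. \<i> * ((2 * pi * r) *\<^sub>R (P (circle r s) + \<i> * Q (circle r s)))) = integral {0..1} (U r)"
      unfolding UV using integral_diff [OF slice [OF r]] intV [OF r] by simp
  qed
  also have "\<dots> = integral {0..1} (\<lambda>s. integral {a..b} (\<lambda>r. U r s))"
    using integral_swap_continuous [OF contU] by simp
  also have "\<dots> = circle_integral b F - circle_integral a F"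
  proof -
    have "(\<lambda>s. 2 * pi * \<i> * to_complex (circle r s) * F (circle r s)) integrable_on {0..1}" if "r \<in> {a..b}" for r
      by (intro integrable_continuous_interval continuous_intros continuous_on_compose2 [OF contF])
         (use in_A [OF that] in auto)
    with \<open>a \<le> b\<close> show ?thesis
      unfolding intU circle_integral_def by (intro integral_diff) auto
  qed
  finally show ?thesis .
qed

section \<open>Vorticity moments over annuli\<close>

text \<open>The sign makes \<open>complex_velocity v\<close> holomorphic exactly where \<open>v\<close> is free of divergence and
  curl, and the real part of \<open>complex_velocity v dz\<close> is \<open>v \<bullet> dl\<close>.\<close>

definition complex_velocity :: "(real^2 \<Rightarrow> real^2) \<Rightarrow> real^2 \<Rightarrow> complex" where
  "complex_velocity v x = Complex (v x $ 1) (- v x $ 2)"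

lemma complex_velocity_eq:
  "complex_velocity v x = of_real (v x $ 1) - \<i> * of_real (v x $ 2)"
  by (simp add: complex_velocity_def complex_eq_iff)

lemma partial_derivative_eq:
  assumes "(f has_derivative f') (at x)"
  shows "partial_derivative j f x = f' (axis j 1)"
proof -
  have "((\<lambda>s. x + s *\<^sub>R axis j 1) has_derivative (\<lambda>s. s *\<^sub>R axis j 1)) (at 0)"
    by (auto intro!: derivative_eq_intros)
  moreover have "(f has_derivative f') (at (x + 0 *\<^sub>R axis j 1))"
    using assms by simp
  ultimately have "((\<lambda>s. f (x + s *\<^sub>R axis j 1)) has_derivative (\<lambda>s. f' (s *\<^sub>R axis j 1))) (at 0)"
    by (rule has_derivative_compose)
  moreover have "(\<lambda>s. f' (s *\<^sub>R axis j 1)) = (*) (f' (axis j 1))"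
    using linear_scale [OF has_derivative_linear [OF assms]] by (simp add: fun_eq_iff)
  ultimately show ?thesis
    unfolding partial_derivative_def by (intro DERIV_imp_deriv) (simp add: has_field_derivative_def)
qed

lemma has_derivative_complex_velocity:
  assumes v: "vector_field r0 v" and x: "norm x > r0"
  shows "(complex_velocity v has_derivative (\<lambda>h.
      h $ 1 *\<^sub>R Complex (partial_derivative 1 (\<lambda>y. v y $ 1) x) (- partial_derivative 1 (\<lambda>y. v y $ 2) x) +
      h $ 2 *\<^sub>R Complex (partial_derivative 2 (\<lambda>y. v y $ 1) x) (- partial_derivative 2 (\<lambda>y. v y $ 2) x))) (at x)"
proof -
  obtain D where D: "(v has_derivative D) (at x)"
    using v x unfolding vector_field_def exterior_def differentiable_def by blast
  have comp: "((\<lambda>y. v y $ i) has_derivative (\<lambda>h. D h $ i)) (at x)" for i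
    by (rule bounded_linear.has_derivative [OF bounded_linear_vec_nth D])
  have lin: "D h $ i = h $ 1 * D (axis 1 1) $ i + h $ 2 * D (axis 2 1) $ i" for h i
    by (subst vec2_eq [of h]) (simp add: linear_add linear_scale has_derivative_linear [OF D])
  have "(complex_velocity v has_derivative (\<lambda>h. of_real (D h $ 1) - \<i> * of_real (D h $ 2))) (at x)"
    unfolding complex_velocity_eq [abs_def]
    by (intro has_derivative_diff has_derivative_of_real comp has_derivative_mult_right)
  then show ?thesis
  proof (rule has_derivative_eq_rhs, intro ext)
    fix h :: "real^2"
    show "of_real (D h $ 1) - \<i> * of_real (D h $ 2) =
      h $ 1 *\<^sub>R Complex (partial_derivative 1 (\<lambda>y. v y $ 1) x) (- partial_derivative 1 (\<lambda>y. v y $ 2) x) +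
      h $ 2 *\<^sub>R Complex (partial_derivative 2 (\<lambda>y. v y $ 1) x) (- partial_derivative 2 (\<lambda>y. v y $ 2) x)"
      unfolding partial_derivative_eq [OF comp] lin [of h] by (simp add: complex_eq_iff)
  qed
qed

lemma continuous_on_complex_velocity:
  assumes "vector_field r0 v"
  shows "continuous_on {x. r0 \<le> norm x} (complex_velocity v)"
  using assms unfolding vector_field_def complex_velocity_eq [abs_def]
  by (intro continuous_intros) auto

lemma has_derivative_inverse_power_to_complex:
  assumes "x \<noteq> 0"
  shows "((\<lambda>y. inverse (to_complex y) ^ n) has_derivative
            (\<lambda>h. - (of_nat n * inverse (to_complex x) ^ Suc n) * to_complex h)) (at x)"
proof -
  have nz: "to_complex x \<noteq> 0"
    using assms by simp
  have "((\<lambda>z. inverse z ^ n) has_field_derivative - (of_nat n * inverse (to_complex x) ^ Suc n)) (at (to_complex x))"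
    by (rule DERIV_cong [OF DERIV_power [OF DERIV_inverse [OF nz]]])
       (cases n; simp add: power2_eq_square mult_ac)
  then show ?thesis
    unfolding has_field_derivative_def
    by (intro has_derivative_compose [OF bounded_linear_imp_has_derivative [OF bounded_linear_to_complex]])
qed

text \<open>Green's theorem for \<open>F = f z\<^sup>-\<^sup>n\<close> with \<open>f\<close> the complex velocity. In \<open>P + \<i> Q\<close>, where \<open>P\<close> and
  \<open>Q\<close> are the partial derivatives of \<open>F\<close>, the terms from differentiating \<open>z\<^sup>-\<^sup>n\<close> cancel by the
  Cauchy-Riemann equations, and vanishing divergence leaves the vorticity only.\<close>

lemma moment_annulus:
  assumes v: "vector_field r0 v" and div: "divergence_free r0 v"
    and "0 \<le> r0" "r0 < a" "a \<le> b"
  shows "integral {x. a \<le> norm x \<and> norm x \<le> b} (\<lambda>x. of_real (curl v x) * inverse (to_complex x) ^ n)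
    = circle_integral b (\<lambda>x. complex_velocity v x * inverse (to_complex x) ^ n)
      - circle_integral a (\<lambda>x. complex_velocity v x * inverse (to_complex x) ^ n)"
proof -
  let ?A = "{x::real^2. a \<le> norm x \<and> norm x \<le> b}"
  define d where "d j x = Complex (partial_derivative j (\<lambda>y. v y $ 1) x) (- partial_derivative j (\<lambda>y. v y $ 2) x)" for j x
  define g where "g x = inverse (to_complex x) ^ n" for x
  define c where "c x = - (of_nat n * inverse (to_complex x) ^ Suc n)" for x
  define P where "P x = d 1 x * g x + complex_velocity v x * c x" for x
  define Q where "Q x = d 2 x * g x + complex_velocity v x * (c x * \<i>)" for x
  have A_sub: "?A \<subseteq> exterior r0" "?A \<subseteq> {x. r0 \<le> norm x}"
    using assms by (auto simp: exterior_def)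
  have nz: "to_complex x \<noteq> 0" if "x \<in> ?A" for x
    using that assms by auto
  have pd: "continuous_on ?A (partial_derivative j (\<lambda>y. v y $ i))" for i j
    using v A_sub(1) unfolding vector_field_def by (blast intro: continuous_on_subset)
  have contd: "continuous_on ?A (d j)" for j
    unfolding d_def by (intro continuous_intros pd)
  have contv: "continuous_on ?A (complex_velocity v)"
    by (rule continuous_on_subset [OF continuous_on_complex_velocity [OF v] A_sub(2)])
  have contg: "continuous_on ?A (\<lambda>x. inverse (to_complex x))"
    by (intro continuous_intros) (use nz in auto)
  have "\<i> * integral ?A (\<lambda>x. P x + \<i> * Q x) = circle_integral b (\<lambda>x. complex_velocity v x * g x)
      - circle_integral a (\<lambda>x. complex_velocity v x * g x)"
  proof (rule green_annulus)
    show "continuous_on ?A P" "continuous_on ?A Q"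
      unfolding P_def Q_def g_def c_def by (intro continuous_intros contd contv contg)+
    fix x :: "real^2"
    assume x: "a \<le> norm x" "norm x \<le> b"
    then have "norm x > r0" "x \<noteq> 0"
      using assms by auto
    from has_derivative_mult [OF has_derivative_complex_velocity [OF v this(1), folded d_def]
        has_derivative_inverse_power_to_complex [OF this(2), of n, folded g_def c_def]]
    show "((\<lambda>x. complex_velocity v x * g x) has_derivative (\<lambda>h. h $ 1 *\<^sub>R P x + h $ 2 *\<^sub>R Q x)) (at x)"
      by (rule has_derivative_eq_rhs)
         (simp add: fun_eq_iff P_def Q_def to_complex_eq scaleR_conv_of_real algebra_simps)
  qed (use assms in auto)
  moreover have "\<i> * (P x + \<i> * Q x) = of_real (curl v x) * g x" if "x \<in> ?A" for x
  proof -
    have "divergence v x = 0"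
      using div that A_sub(1) by (auto simp: divergence_free_def)
    then have "\<i> * (d 1 x + \<i> * d 2 x) = of_real (curl v x)"
      by (simp add: d_def complex_eq_iff divergence_def curl_def)
    moreover have "\<i> * (P x + \<i> * Q x) = \<i> * (d 1 x + \<i> * d 2 x) * g x"
      by (simp add: P_def Q_def algebra_simps)
    ultimately show ?thesis by simp
  qed
  then have "integral ?A (\<lambda>x. of_real (curl v x) * g x) = integral ?A (\<lambda>x. \<i> * (P x + \<i> * Q x))"
    by (intro integral_cong) simp
  ultimately show ?thesis
    unfolding g_def by simp
qed

section \<open>Limits of the boundary integrals\<close>

lemma continuous_on_moment_integrand:
  assumes "vector_field r0 v" "r0 > 0"
  shows "continuous_on {x. r0 \<le> norm x} (\<lambda>x. complex_velocity v x * inverse (to_complex x) ^ n)"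
  using \<open>r0 > 0\<close>
  by (intro continuous_intros continuous_on_complex_velocity [OF assms(1)]) auto

text \<open>Fields need not be differentiable on the boundary circle, so Green's theorem cannot be applied
  up to the circle of radius \<open>r0\<close>. But the contour integral depends continuously on the radius down to
  \<open>r0\<close>, which suffices to approach that circle from outside.\<close>

lemma circle_integral_tendsto_0_inner:
  assumes "r0 \<ge> 0" and cont: "continuous_on {x. r0 \<le> norm x} F"
    and zero: "\<And>x. norm x = r0 \<Longrightarrow> F x = 0"
    and a: "a \<longlonglongrightarrow> r0" "\<And>i. r0 \<le> a i"
  shows "(\<lambda>i. circle_integral (a i) F) \<longlonglongrightarrow> 0"
proof -
  have "continuous_on {r0..} (\<lambda>r. circle_integral r F)"
    unfolding circle_integral_def cbox_interval [symmetric] case_prod_beta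
  proof (rule integral_continuous_on_param, unfold case_prod_beta,
      intro continuous_intros continuous_on_compose2 [OF cont])
    show "(\<lambda>q. circle (fst q) (snd q)) ` ({r0..} \<times> cbox 0 1) \<subseteq> {x. r0 \<le> norm x}"
      using \<open>r0 \<ge> 0\<close> by (auto simp: norm_circle)
  qed
  from continuous_on_tendsto_compose [OF this a(1)] a(2)
  have "(\<lambda>i. circle_integral (a i) F) \<longlonglongrightarrow> circle_integral r0 F"
    by simp
  moreover have "circle_integral r0 F = 0"
    unfolding circle_integral_def using \<open>r0 \<ge> 0\<close> by (simp add: zero norm_circle)
  ultimately show ?thesis by simp
qed

text \<open>Since \<open>dz / z = 2 \<pi> \<i> ds\<close>, the contour integral is \<open>2 \<pi> \<i>\<close> times the mean of \<open>z F\<close> over the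
  circle, and on large circles \<open>z F\<close> is uniformly close to its limit.\<close>

lemma circle_integral_tendsto_residue:
  assumes F: "continuous_on {x. r0 \<le> norm x} F"
    and L: "((\<lambda>x. to_complex x * F x) \<longlongrightarrow> L) at_infinity"
  shows "((\<lambda>r. circle_integral r F) \<longlongrightarrow> 2 * pi * \<i> * L) at_top"
proof (rule tendstoI)
  fix e :: real
  assume "e > 0"
  then have "e / (4 * pi) > 0" by simp
  from tendstoD [OF L this] obtain B
    where B: "\<And>x. norm x \<ge> B \<Longrightarrow> dist (to_complex x * F x) L < e / (4 * pi)"
    unfolding eventually_at_infinity by blast
  show "\<forall>\<^sub>F r in at_top. dist (circle_integral r F) (2 * pi * \<i> * L) < e"
    using eventually_ge_at_top [of "max (max 0 r0) B"]
  proof eventually_elim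
    case (elim r)
    let ?f = "\<lambda>s. 2 * pi * \<i> * to_complex (circle r s) * F (circle r s)"
    have contf: "continuous_on {0..1} ?f"
      by (intro continuous_intros continuous_on_compose2 [OF F]) (use elim in \<open>auto simp: norm_circle\<close>)
    have "circle_integral r F - 2 * pi * \<i> * L = integral {0..1} (\<lambda>s. ?f s - 2 * pi * \<i> * L)"
      unfolding circle_integral_def
      using integral_diff [OF integrable_continuous_interval [OF contf] integrable_const_ivl]
      by simp
    also have "norm \<dots> \<le> (e / 2) * (1 - 0)"
    proof (rule integral_bound)
      fix s :: real
      have "?f s - 2 * pi * \<i> * L = 2 * pi * \<i> * (to_complex (circle r s) * F (circle r s) - L)"
        by (simp add: algebra_simps)
      also have "norm \<dots> = 2 * pi * dist (to_complex (circle r s) * F (circle r s)) L"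
        by (simp add: norm_mult dist_norm)
      also have "\<dots> \<le> 2 * pi * (e / (4 * pi))"
        using B [of "circle r s"] elim by (intro mult_left_mono) (auto simp: norm_circle)
      finally show "norm (?f s - 2 * pi * \<i> * L) \<le> e / 2"
        by simp
    next
      show "continuous_on {0..1} (\<lambda>s. ?f s - 2 * pi * \<i> * L)"
        by (intro continuous_on_diff contf continuous_on_const)
    qed simp
    finally show ?case
      using \<open>e > 0\<close> by (simp add: dist_norm)
  qed
qed

lemma complex_velocity_tendsto:
  assumes "(v \<longlongrightarrow> vinf) at_infinity"
  shows "(complex_velocity v \<longlongrightarrow> of_real (vinf $ 1) - \<i> * of_real (vinf $ 2)) at_infinity"
  unfolding complex_velocity_eq [abs_def] by (intro tendsto_intros tendsto_vec_nth assms)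

lemma inverse_to_complex_tendsto_0: "((\<lambda>x. inverse (to_complex x)) \<longlongrightarrow> 0) at_infinity"
proof (rule filterlim_compose [OF tendsto_inverse_0])
  show "filterlim to_complex at_infinity at_infinity"
    by (rule filterlim_norm_at_top_imp_at_infinity)
       (simp add: norm_to_complex filterlim_norm_at_top)
qed

text \<open>Here \<open>z F = f z\<^bsup>1-n\<^esup>\<close>, so only \<open>n = 1\<close> sees the velocity at infinity. For \<open>n \<ge> 2\<close> both
  the limit and the radial coefficient are \<open>0\<close>.\<close>

lemma circle_integral_moment_tendsto:
  assumes v: "vector_field r0 v" and "r0 > 0" and lim: "(v \<longlongrightarrow> vinf) at_infinity" and "n \<ge> 1"
  shows "((\<lambda>r. circle_integral r (\<lambda>x. complex_velocity v x * inverse (to_complex x) ^ n))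
      \<longlongrightarrow> 4 * pi * \<i> * of_nat n * radial_coeff vinf (int n)) at_top"
proof -
  obtain m where n: "n = Suc m"
    using \<open>n \<ge> 1\<close> by (cases n) auto
  define L where "L = (if m = 0 then of_real (vinf $ 1) - \<i> * of_real (vinf $ 2) else (0 :: complex))"
  have "((\<lambda>x. complex_velocity v x * inverse (to_complex x) ^ m) \<longlongrightarrow> L) at_infinity"
  proof (cases "m = 0")
    case True
    with complex_velocity_tendsto [OF lim] show ?thesis by (simp add: L_def)
  next
    case False
    with tendsto_mult [OF complex_velocity_tendsto [OF lim] tendsto_power [OF inverse_to_complex_tendsto_0, of m]]
    show ?thesis by (simp add: L_def power_0_left)
  qed
  moreover have "\<forall>\<^sub>F x in at_infinity. complex_velocity v x * inverse (to_complex x) ^ m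
      = to_complex x * (complex_velocity v x * inverse (to_complex x) ^ n)"
  proof -
    have "to_complex x \<noteq> 0" if "norm x \<ge> 1" for x
      using that by auto
    then show ?thesis
      unfolding eventually_at_infinity n by (intro exI [of _ 1]) simp
  qed
  ultimately have "((\<lambda>x. to_complex x * (complex_velocity v x * inverse (to_complex x) ^ n)) \<longlongrightarrow> L) at_infinity"
    by (rule Lim_transform_eventually)
  then have "((\<lambda>r. circle_integral r (\<lambda>x. complex_velocity v x * inverse (to_complex x) ^ n))
      \<longlongrightarrow> 2 * pi * \<i> * L) at_top"
    by (rule circle_integral_tendsto_residue [OF continuous_on_moment_integrand [OF v \<open>r0 > 0\<close>]])
  also have "2 * pi * \<i> * L = 4 * pi * \<i> * of_nat n * radial_coeff vinf (int n)"
    by (simp add: L_def radial_coeff_def n)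
  finally show ?thesis .
qed

lemma Re_circle_integral_complex_velocity:
  assumes v: "vector_field r0 v" and "0 \<le> r" "r0 \<le> r"
  shows "Re (circle_integral r (complex_velocity v)) = line_integral (circle r) v"
proof -
  let ?f = "\<lambda>s. 2 * pi * \<i> * to_complex (circle r s) * complex_velocity v (circle r s)"
  have "?f integrable_on {0..1}"
    by (intro integrable_continuous_interval continuous_intros
          continuous_on_compose2 [OF continuous_on_complex_velocity [OF v]])
       (use assms in \<open>auto simp: norm_circle\<close>)
  from integral_linear [OF this bounded_linear_Re]
  have "Re (circle_integral r (complex_velocity v)) = integral {0..1} (\<lambda>s. Re (?f s))"
    by (simp add: circle_integral_def o_def)
  also have "\<dots> = line_integral (circle r) v"
    unfolding line_integral_def
  proof (rule integral_cong)
    fix s :: real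
    assume "s \<in> {0..1}"
    then have "vector_derivative (circle r) (at s within {0..1})
      = vector [- (2 * pi * r * sin (2 * pi * s)), 2 * pi * r * cos (2 * pi * s)]"
      using has_vector_derivative_circle_angle by (intro vector_derivative_within_closed_interval) auto
    then show "Re (?f s) = v (circle r s) \<bullet> vector_derivative (circle r) (at s within {0..1})"
      by (simp add: to_complex_circle complex_velocity_def inner_vec_def sum_2 algebra_simps)
  qed
  finally show ?thesis .
qed

section \<open>Vorticity moments over the exterior domain\<close>

lemma integrable_moment:
  assumes "r0 > 0" and w: "w \<in> L1 (exterior r0)"
  shows "set_integrable lebesgue (exterior r0) (\<lambda>x. complex_of_real (w x) * inverse (to_complex x) ^ n)"
proof -
  have w': "integrable lebesgue (\<lambda>x. indicat_real (exterior r0) x * w x)"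
    using w by (simp add: L1_def set_integrable_def)
  have "to_complex \<in> borel_measurable borel"
    using bounded_linear_to_complex by (intro borel_measurable_continuous_onI linear_continuous_on)
  then have [measurable]: "to_complex \<in> borel_measurable lebesgue"
    by (simp add: measurable_completion)
  have "integrable lebesgue
      (\<lambda>x. of_real (indicat_real (exterior r0) x * w x) * inverse (to_complex x) ^ n)"
  proof (rule Bochner_Integration.integrable_bound [OF integrable_mult_right [OF w', of "inverse r0 ^ n"]])
    from borel_measurable_integrable [OF w']
    show "(\<lambda>x. of_real (indicat_real (exterior r0) x * w x) * inverse (to_complex x) ^ n)
        \<in> borel_measurable lebesgue"
      by measurable
    have "norm (of_real (indicat_real (exterior r0) x * w x) * inverse (to_complex x) ^ n)
        \<le> norm (inverse r0 ^ n * (indicat_real (exterior r0) x * w x))" for x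
    proof (cases "x \<in> exterior r0")
      case True
      then have "inverse (norm x) ^ n \<le> inverse r0 ^ n"
        using \<open>r0 > 0\<close> by (intro power_mono le_imp_inverse_le) (auto simp: exterior_def)
      then have "\<bar>w x\<bar> * inverse (norm x) ^ n \<le> \<bar>w x\<bar> * inverse r0 ^ n"
        by (intro mult_left_mono) auto
      with True \<open>r0 > 0\<close> show ?thesis
        by (simp add: norm_mult norm_power norm_inverse norm_to_complex abs_mult mult.commute)
    qed simp
    then show "AE x in lebesgue. norm (of_real (indicat_real (exterior r0) x * w x) * inverse (to_complex x) ^ n)
        \<le> norm (inverse r0 ^ n * (indicat_real (exterior r0) x * w x))"
      by simp
  qed
  then show ?thesis
    by (simp add: set_integrable_def scaleR_conv_of_real mult.assoc)
qed

lemma exterior_eq_UN_annuli: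
  "exterior r0 = (\<Union>i. {x. r0 + inverse (real (Suc i)) \<le> norm x \<and> norm x \<le> r0 + 1 + real i})"
proof (intro equalityI subsetI)
  fix x :: "real^2"
  assume "x \<in> exterior r0"
  then have "norm x - r0 > 0" by (simp add: exterior_def)
  then obtain i where i: "inverse (real (Suc i)) < norm x - r0"
    using reals_Archimedean by blast
  obtain j :: nat where j: "norm x - r0 \<le> real j"
    using real_arch_simple by blast
  have "inverse (real (Suc (max i j))) \<le> inverse (real (Suc i))"
    by (intro le_imp_inverse_le) auto
  with i j have "r0 + inverse (real (Suc (max i j))) \<le> norm x" "norm x \<le> r0 + 1 + real (max i j)"
    by linarith+
  then show "x \<in> (\<Union>i. {x. r0 + inverse (real (Suc i)) \<le> norm x \<and> norm x \<le> r0 + 1 + real i})"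
    by blast
next
  fix x :: "real^2"
  assume "x \<in> (\<Union>i. {x. r0 + inverse (real (Suc i)) \<le> norm x \<and> norm x \<le> r0 + 1 + real i})"
  then obtain i where "r0 + inverse (real (Suc i)) \<le> norm x" by blast
  moreover have "inverse (real (Suc i)) > 0" by simp
  ultimately show "x \<in> exterior r0"
    unfolding exterior_def by (simp only: mem_Collect_eq)
qed

text \<open>Dominated convergence along the annuli with radii \<open>a i\<close> and \<open>b i\<close> exhausting the exterior domain:
  their moments are differences of two contour integrals, and the inner ones tend to \<open>0\<close> by the
  no-slip condition.\<close>

lemma moment_eq_limit_circle_integral:
  assumes "r0 > 0" and v: "vector_field r0 v" and div: "divergence_free r0 v"
    and L1: "curl v \<in> L1 (exterior r0)" and slip: "no_slip r0 v"
  shows "(\<lambda>i. circle_integral (r0 + 1 + real i) (\<lambda>x. complex_velocity v x * inverse (to_complex x) ^ n))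
    \<longlonglongrightarrow> (LINT x : exterior r0 | lebesgue. complex_of_real (curl v x) * inverse (to_complex x) ^ n)"
proof -
  let ?F = "\<lambda>x. complex_velocity v x * inverse (to_complex x) ^ n"
  let ?w = "\<lambda>x. complex_of_real (curl v x) * inverse (to_complex x) ^ n"
  define a where "a i = r0 + inverse (real (Suc i))" for i
  define b where "b i = r0 + 1 + real i" for i
  define A where "A i = {x::real^2. a i \<le> norm x \<and> norm x \<le> b i}" for i
  have UN_A: "(\<Union>i. A i) = exterior r0"
    by (simp add: A_def a_def b_def exterior_eq_UN_annuli)
  have a_gt: "a i > r0" for i
    by (simp add: a_def)
  have ab: "a i \<le> b i" for i
    using inverse_le_1_iff [of "real (Suc i)"] by (simp add: a_def b_def del: inverse_le_1_iff)
  have A_meas: "A i \<in> sets lebesgue" for i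
  proof -
    have "closed (A i)"
      unfolding A_def by (intro closed_Collect_conj closed_Collect_le continuous_intros)
    then show ?thesis by (auto intro: borel_closed)
  qed
  have "incseq A"
  proof (rule incseq_SucI)
    have "a (Suc i) \<le> a i" for i
      unfolding a_def by (intro add_left_mono le_imp_inverse_le) auto
    moreover have "b i \<le> b (Suc i)" for i
      by (simp add: b_def)
    ultimately show "A i \<subseteq> A (Suc i)" for i
      unfolding A_def by (blast intro: order_trans)
  qed
  have int: "set_integrable lebesgue (exterior r0) ?w"
    by (rule integrable_moment [OF \<open>r0 > 0\<close> L1])
  have "(\<lambda>i. LINT x : A i | lebesgue. ?w x) \<longlonglongrightarrow> (LINT x : exterior r0 | lebesgue. ?w x)"
    using set_integral_cont_up [OF A_meas \<open>incseq A\<close>, of ?w] int by (simp add: UN_A)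
  moreover have "(LINT x : A i | lebesgue. ?w x) = circle_integral (b i) ?F - circle_integral (a i) ?F" for i
  proof -
    have "A i \<subseteq> exterior r0" using UN_A by blast
    then have "set_integrable lebesgue (A i) ?w"
      by (rule set_integrable_subset [OF int A_meas])
    then have "(LINT x : A i | lebesgue. ?w x) = integral (A i) ?w"
      by (rule set_lebesgue_integral_eq_integral)
    also have "\<dots> = circle_integral (b i) ?F - circle_integral (a i) ?F"
      unfolding A_def by (rule moment_annulus [OF v div _ a_gt ab]) (use \<open>r0 > 0\<close> in simp)
    finally show ?thesis .
  qed
  ultimately have "(\<lambda>i. circle_integral (b i) ?F - circle_integral (a i) ?F)
      \<longlonglongrightarrow> (LINT x : exterior r0 | lebesgue. ?w x)"
    by simp
  moreover have "(\<lambda>i. circle_integral (a i) ?F) \<longlonglongrightarrow> 0"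
  proof (rule circle_integral_tendsto_0_inner)
    show "continuous_on {x. r0 \<le> norm x} ?F"
      by (rule continuous_on_moment_integrand [OF v \<open>r0 > 0\<close>])
    show "?F x = 0" if "norm x = r0" for x
      using slip that by (simp add: no_slip_def complex_velocity_eq)
    show "a \<longlonglongrightarrow> r0"
      using tendsto_add [OF tendsto_const LIMSEQ_inverse_real_of_nat, of r0] by (simp add: a_def [abs_def])
  qed (use \<open>r0 > 0\<close> a_gt less_imp_le in auto)
  ultimately have "(\<lambda>i. (circle_integral (b i) ?F - circle_integral (a i) ?F) + circle_integral (a i) ?F)
      \<longlonglongrightarrow> (LINT x : exterior r0 | lebesgue. ?w x) + 0"
    by (rule tendsto_add)
  then show ?thesis by (simp add: b_def)
qed

text \<open>The whole theorem at one instant: only the limit of the outer contour integral remains to be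
  identified, and it is unique.\<close>

lemma no_slip_imp_curl_in_moment_space:
  assumes "r0 > 0" and v: "vector_field r0 v" and div: "divergence_free r0 v"
    and L1: "curl v \<in> L1 (exterior r0)" and slip: "no_slip r0 v"
    and lim: "(v \<longlongrightarrow> vinf) at_infinity" and circ: "zero_circularity v"
  shows "curl v \<in> moment_space r0 vinf"
proof -
  let ?F = "\<lambda>n x. complex_velocity v x * inverse (to_complex x) ^ n"
  let ?M = "\<lambda>n. LINT x : exterior r0 | lebesgue. complex_of_real (curl v x) * inverse (to_complex x) ^ n"
  have radii: "filterlim (\<lambda>i. r0 + 1 + real i) at_top sequentially"
    by (rule filterlim_tendsto_add_at_top [OF tendsto_const filterlim_real_sequentially])
  have M: "(\<lambda>i. circle_integral (r0 + 1 + real i) (?F n)) \<longlonglongrightarrow> ?M n" for n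
    by (rule moment_eq_limit_circle_integral [OF \<open>r0 > 0\<close> v div L1 slip])
  have "?M n = 4 * pi * \<i> * of_nat n * radial_coeff vinf (int n)" for n
  proof (cases "n = 0")
    case True
    \<comment> \<open>Zero circularity controls the real part only; the imaginary part vanishes as the moment is real.\<close>
    have "(\<lambda>i. line_integral (circle (r0 + 1 + real i)) v) \<longlonglongrightarrow> 0"
      using circ filterlim_compose [OF _ radii] unfolding zero_circularity_def by blast
    moreover have "line_integral (circle (r0 + 1 + real i)) v = Re (circle_integral (r0 + 1 + real i) (?F 0))" for i
      using Re_circle_integral_complex_velocity [OF v] \<open>r0 > 0\<close> by simp
    ultimately have "Re (?M 0) = 0"
      using tendsto_Re [OF M [of 0]] LIMSEQ_unique by simp blast
    moreover have "?M 0 = of_real (LINT x : exterior r0 | lebesgue. curl v x)"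
      by (simp add: set_integral_complex_of_real)
    ultimately show ?thesis
      using True by simp
  next
    case False
    then have "n \<ge> 1" by simp
    from filterlim_compose [OF circle_integral_moment_tendsto [OF v \<open>r0 > 0\<close> lim this] radii]
    show ?thesis
      by (rule LIMSEQ_unique [OF M])
  qed
  note M_eq = this
  have "(LINT x : exterior r0 | lebesgue. complex_of_real (curl v x) / to_complex x powi k)
      = 4 * complex_of_real pi * \<i> * of_int k * radial_coeff vinf k" if "k \<ge> 0" for k
    using M_eq [of "nat k"] that by (simp add: power_int_def power_inverse divide_inverse)
  with L1 show ?thesis
    by (simp add: moment_space_def)
qed

theorem theorem2p2:
  fixes r0 :: real
    and vinf :: "real^2"
    and v0 :: "real^2 \<Rightarrow> real^2"
    and v :: "real \<Rightarrow> real^2 \<Rightarrow> real^2"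
  assumes "r0 > 0"
    and "vector_field r0 v0"
    and "divergence_free r0 v0"
    and "curl v0 \<in> L1 (exterior r0)"
    and "no_slip r0 v0"
    and "(v0 \<longlongrightarrow> vinf) at_infinity"
    and "zero_circularity v0"
    and "\<And>t. t \<ge> 0 \<Longrightarrow> vector_field r0 (v t)"
    and "\<And>t. t \<ge> 0 \<Longrightarrow> divergence_free r0 (v t)"
    and "\<And>t. t \<ge> 0 \<Longrightarrow> curl (v t) \<in> L1 (exterior r0)"
    and "\<And>t. t \<ge> 0 \<Longrightarrow> (v t \<longlongrightarrow> vinf) at_infinity"
    and "\<And>t. t \<ge> 0 \<Longrightarrow> zero_circularity (v t)"
    and "\<And>x. norm x \<ge> r0 \<Longrightarrow> v 0 x = v0 x"
  shows "curl v0 \<in> moment_space r0 vinf \<and>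
    ((\<forall>t>0. no_slip r0 (v t)) \<longrightarrow> (\<forall>t>0. curl (v t) \<in> moment_space r0 vinf))"
proof (intro conjI impI allI)
  show "curl v0 \<in> moment_space r0 vinf"
    by (rule no_slip_imp_curl_in_moment_space) (fact assms)+
next
  fix t :: real
  assume "\<forall>t>0. no_slip r0 (v t)" and "t > 0"
  then show "curl (v t) \<in> moment_space r0 vinf"
    using assms(1,8-12) by (intro no_slip_imp_curl_in_moment_space) auto
qed

end
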